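(* Let $T$ be any special Aronszajn tree. Then there is a set $B \subseteq \mathbb{R}$ with no Cantor subsets and a map $\psi : T \to B$ that is continuous (with respect to the tree topology on $T$) and order preserving, such that for all $x, y \in T$, $\psi(x) \ne \psi(y)$ unless $x{\downarrow} = y{\downarrow}$.
   Context: A tree is a set $T$ with a strict partial order $\sqsubset$ such that for each $x \in T$ the set $x{\downarrow} = \{y \in T : y \sqsubset x\}$ is well-ordered by $\sqsubset$. Also $x{\uparrow} = \{y \in T : x \sqsubset y\}$. The height $\mathrm{height}(x)$ is the order type of $x{\downarrow}$, and $\mathcal{L}_\alpha(T) = \{x \in T : \mathrm{height}(x) = \alpha\}$. $T$ is an $\omega_1$-tree iff $|T| = \aleph_1$, each $\mathcal{L}_\alpha(T)$ is countable, and $\mathcal{L}_{\omega_1}(T) = \emptyset$. An Aronszajn tree is an $\omega_1$-tree with no uncountable chains; it is special iff it is a countable union of antichains (an antichain being a set of pairwise $\sqsubset$-incomparable elements). Tree topology on $T$: $U \subseteq T$ is open iff for all $y \in U$ with $\mathrm{height}(y)$ a (nonzero) limit ordinal, there is an $x \sqsubset y$ such that $x{\uparrow} \cap y{\downarrow} \subseteq U$. (This topology need not be Hausdorff.) A map $\psi : T \to \mathbb{R}$ is order preserving iff $x \sqsubset y$ implies $\psi(x) < \psi(y)$ for all $x, y \in T$. $B$ carries the subspace topology from $\mathbb{R}$. A Cantor subset is a subset homeomorphic to $2^\omega$. The theorem is in ZFC. *)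

theory Defs
  imports "HOL-Analysis.Analysis"
begin

definition down :: "'a set \<Rightarrow> ('a \<Rightarrow> 'a \<Rightarrow> bool) \<Rightarrow> 'a \<Rightarrow> 'a set" where
  "down T lt x = {y \<in> T. lt y x}"

definition up :: "'a set \<Rightarrow> ('a \<Rightarrow> 'a \<Rightarrow> bool) \<Rightarrow> 'a \<Rightarrow> 'a set" where
  "up T lt x = {y \<in> T. lt x y}"

text \<open>Well-orders stand for ordinals: the height of \<open>x\<close> is the reflexive closure of the order on
  the predecessors of \<open>x\<close> (the library's well-orders are reflexive), to be read up to order
  isomorphism \<open>ordIso\<close>.\<close>

definition height :: "'a set \<Rightarrow> ('a \<Rightarrow> 'a \<Rightarrow> bool) \<Rightarrow> 'a \<Rightarrow> 'a rel" where
  "height T lt x = {(y, z). y \<in> down T lt x \<and> z \<in> down T lt x \<and> (y = z \<or> lt y z)}"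

definition is_tree :: "'a set \<Rightarrow> ('a \<Rightarrow> 'a \<Rightarrow> bool) \<Rightarrow> bool" where
  "is_tree T lt \<longleftrightarrow> irreflp_on T lt \<and> transp_on T lt \<and>
     (\<forall>x\<in>T. well_order_on (down T lt x) (height T lt x))"

definition level :: "'a set \<Rightarrow> ('a \<Rightarrow> 'a \<Rightarrow> bool) \<Rightarrow> 'b rel \<Rightarrow> 'a set" where
  "level T lt \<alpha> = {x \<in> T. (height T lt x, \<alpha>) \<in> ordIso}"

text \<open>The library's \<open>cardSuc natLeq\<close> is a well-order of type \<open>\<omega>\<^sub>1\<close> (and the cardinal \<open>\<aleph>\<^sub>1\<close>).
  Ordinals represented on the type \<open>'a\<close> suffice in the second condition, since heights of
  elements of \<open>T\<close> are themselves of type \<open>'a rel\<close>; see \<open>countable_level\<close> below.\<close>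

definition is_omega1_tree :: "'a set \<Rightarrow> ('a \<Rightarrow> 'a \<Rightarrow> bool) \<Rightarrow> bool" where
  "is_omega1_tree T lt \<longleftrightarrow> is_tree T lt \<and> (card_of T, cardSuc natLeq) \<in> ordIso \<and>
     (\<forall>\<alpha> :: 'a rel. Well_order \<alpha> \<longrightarrow> countable (level T lt \<alpha>)) \<and>
     level T lt (cardSuc natLeq) = {}"

definition is_antichain :: "'a set \<Rightarrow> ('a \<Rightarrow> 'a \<Rightarrow> bool) \<Rightarrow> 'a set \<Rightarrow> bool" where
  "is_antichain T lt A \<longleftrightarrow> A \<subseteq> T \<and> pairwise (\<lambda>x y. \<not> lt x y \<and> \<not> lt y x) A"

definition is_aronszajn_tree :: "'a set \<Rightarrow> ('a \<Rightarrow> 'a \<Rightarrow> bool) \<Rightarrow> bool" where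
  "is_aronszajn_tree T lt \<longleftrightarrow> is_omega1_tree T lt \<and>
     (\<forall>C\<subseteq>T. totalp_on C lt \<longrightarrow> countable C)"

definition is_special_aronszajn_tree :: "'a set \<Rightarrow> ('a \<Rightarrow> 'a \<Rightarrow> bool) \<Rightarrow> bool" where
  "is_special_aronszajn_tree T lt \<longleftrightarrow> is_aronszajn_tree T lt \<and>
     (\<exists>A :: nat \<Rightarrow> 'a set. (\<forall>n. is_antichain T lt (A n)) \<and> T = (\<Union>n. A n))"

text \<open>Nonzero limit ordinal: nonempty without a largest element.\<close>

definition is_limit_ord :: "'b rel \<Rightarrow> bool" where
  "is_limit_ord r \<longleftrightarrow> Well_order r \<and> Field r \<noteq> {} \<and>
     \<not> (\<exists>j \<in> Field r. \<forall>i \<in> Field r. (i, j) \<in> r)"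

definition tree_open :: "'a set \<Rightarrow> ('a \<Rightarrow> 'a \<Rightarrow> bool) \<Rightarrow> 'a set \<Rightarrow> bool" where
  "tree_open T lt U \<longleftrightarrow> U \<subseteq> T \<and>
     (\<forall>y\<in>U. is_limit_ord (height T lt y) \<longrightarrow>
       (\<exists>x\<in>T. lt x y \<and> up T lt x \<inter> down T lt y \<subseteq> U))"

definition tree_topology :: "'a set \<Rightarrow> ('a \<Rightarrow> 'a \<Rightarrow> bool) \<Rightarrow> 'a topology" where
  "tree_topology T lt = topology (tree_open T lt)"

definition is_cantor_subset :: "'a::topological_space set \<Rightarrow> bool" where
  "is_cantor_subset C \<longleftrightarrow>
     top_of_set C homeomorphic_space
       product_topology (\<lambda>_::nat. discrete_topology (UNIV :: bool set)) UNIV"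

lemma Field_height: "Field (height T lt x) = down T lt x"
  by (auto simp: Field_def height_def)

lemma istopology_tree_open:
  assumes "is_tree T lt"
  shows "istopology (tree_open T lt)"
  unfolding istopology_def
proof (intro conjI allI impI)
  fix U V assume U: "tree_open T lt U" and V: "tree_open T lt V"
  show "tree_open T lt (U \<inter> V)"
    unfolding tree_open_def
  proof (intro conjI ballI impI)
    show "U \<inter> V \<subseteq> T"
      using U by (auto simp: tree_open_def)
    fix y assume y: "y \<in> U \<inter> V" and lim: "is_limit_ord (height T lt y)"
    then have yT: "y \<in> T" using U by (auto simp: tree_open_def)
    obtain u where u: "u \<in> T" "lt u y" "up T lt u \<inter> down T lt y \<subseteq> U"
      using U y lim unfolding tree_open_def by blast
    obtain v where v: "v \<in> T" "lt v y" "up T lt v \<inter> down T lt y \<subseteq> V"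
      using V y lim unfolding tree_open_def by blast
    have "total_on (down T lt y) (height T lt y)"
      using assms yT unfolding is_tree_def well_order_on_def linear_order_on_def by blast
    then have "u = v \<or> lt u v \<or> lt v u"
      using u(1,2) v(1,2) unfolding total_on_def height_def down_def by blast
    moreover have "transp_on T lt"
      using assms by (simp add: is_tree_def)
    then have "up T lt b \<subseteq> up T lt a" if "lt a b" "a \<in> T" "b \<in> T" for a b
      using that unfolding up_def by (blast dest: transp_onD)
    ultimately consider "up T lt v \<subseteq> up T lt u" | "up T lt u \<subseteq> up T lt v"
      using u(1) v(1) by blast
    then show "\<exists>x\<in>T. lt x y \<and> up T lt x \<inter> down T lt y \<subseteq> U \<inter> V"
    proof cases
      case 1
      then have "up T lt v \<inter> down T lt y \<subseteq> U \<inter> V" using u(3) v(3) by blast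
      then show ?thesis using v(1,2) by blast
    next
      case 2
      then have "up T lt u \<inter> down T lt y \<subseteq> U \<inter> V" using u(3) v(3) by blast
      then show ?thesis using u(1,2) by blast
    qed
  qed
next
  fix \<K> assume K: "\<forall>K\<in>\<K>. tree_open T lt K"
  show "tree_open T lt (\<Union>\<K>)"
    unfolding tree_open_def
  proof (intro conjI ballI impI)
    show "\<Union>\<K> \<subseteq> T" using K by (auto simp: tree_open_def)
    fix y assume "y \<in> \<Union>\<K>" and lim: "is_limit_ord (height T lt y)"
    then obtain K where "K \<in> \<K>" "y \<in> K" by auto
    then obtain x where "x \<in> T" "lt x y" "up T lt x \<inter> down T lt y \<subseteq> K"
      using K lim unfolding tree_open_def by blast
    then show "\<exists>x\<in>T. lt x y \<and> up T lt x \<inter> down T lt y \<subseteq> \<Union>\<K>"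
      using \<open>K \<in> \<K>\<close> by blast
  qed
qed

lemma openin_tree_topology:
  assumes "is_tree T lt"
  shows "openin (tree_topology T lt) U \<longleftrightarrow> tree_open T lt U"
  unfolding tree_topology_def
  using istopology_tree_open[OF assms] by (simp add: topology_inverse')

lemma topspace_tree_topology:
  assumes "is_tree T lt"
  shows "topspace (tree_topology T lt) = T"
proof -
  have "tree_open T lt T"
    unfolding tree_open_def
  proof (intro conjI ballI impI)
    fix y assume "y \<in> T" "is_limit_ord (height T lt y)"
    then obtain x where "x \<in> down T lt y"
      by (auto simp: is_limit_ord_def Field_height)
    then show "\<exists>x\<in>T. lt x y \<and> up T lt x \<inter> down T lt y \<subseteq> T"
      by (auto simp: down_def up_def)
  qed auto
  then show ?thesis
    unfolding topspace_def openin_tree_topology[OF assms] tree_open_def by blast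
qed

lemma countable_level:
  assumes "is_omega1_tree T lt"
  shows "countable (level T lt \<alpha>)"
proof (cases "level T lt \<alpha> = {}")
  case False
  then obtain x where x: "x \<in> T" "(height T lt x, \<alpha>) \<in> ordIso" by (auto simp: level_def)
  have "Well_order (height T lt x)"
    using assms x(1) unfolding is_omega1_tree_def is_tree_def Field_height by blast
  moreover have "level T lt \<alpha> \<subseteq> level T lt (height T lt x)"
    using ordIso_transitive[OF _ ordIso_symmetric[OF x(2)]] unfolding level_def by blast
  ultimately show ?thesis
    using assms countable_subset unfolding is_omega1_tree_def by metis
qed simp

end

theory Submission
  imports Defs
begin

text \<open>
  Since the tree is special and its levels are countable, its nodes can be labelled by natural
  numbers so that labels are distinct along every chain and distinct among nodes with the same
  predecessors. A node \<open>x\<close> is then sent to the real number whose ternary digits, all \<open>0\<close> or \<open>1\<close>,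
  form the characteristic function of the well-order \<open>{(m z, m y). z \<sqsubseteq> y \<sqsubset> x}\<close> that the
  labelling \<open>m\<close> induces on the labels of the predecessors of \<open>x\<close>. This set of pairs grows
  strictly with \<open>x\<close>, at a limit node it is the union of the earlier ones, and it determines the
  predecessors of \<open>x\<close> by recursion along the chain. So the map is order preserving, continuous and
  separates nodes with distinct predecessors (\<open>node_real_strict_mono\<close>, \<open>continuous_node_real\<close>,
  \<open>node_real_inj\<close>).

  The image \<open>B\<close> has no Cantor subset because every compact subset of \<open>B\<close> is countable
  (\<open>countable_compact_subset\<close>). This is the boundedness principle for sets of well-orders of
  \<open>\<nat>\<close>, in a form that avoids ordinal ranks. Digits depend continuously on the real they
  expand, so a compact set of such reals is a compact set of well-orders. Were it uncountable, then
  repeated use of the pigeonhole principle would give a sequence of labels each finite part of which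
  is descending in a member of the set. By compactness the whole sequence is descending in a single
  member, against well-foundedness. The pigeonhole argument can be repeated because the nodes
  below an uncountable set of nodes form an uncountable set (\<open>uncountable_below\<close>); this is where
  countability of the levels enters a second time.
\<close>

section \<open>Ternary expansions with digits 0 and 1\<close>

definition ternary :: "nat set \<Rightarrow> real" where
  "ternary A = (\<Sum>k. indicator A k * (1/3) ^ k)"

lemma summable_ternary: "summable (\<lambda>k. indicator A k * (1/3 :: real) ^ k)"
proof (rule summable_comparison_test'[of "\<lambda>k. (1/3 :: real) ^ k" 0])
  show "summable (\<lambda>k. (1/3 :: real) ^ k)" by (rule summable_geometric) simp
qed (simp add: indicator_def)

lemma ternary_mono: "A \<subseteq> B \<Longrightarrow> ternary A \<le> ternary B"
  unfolding ternary_def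
  by (rule suminf_le[OF _ summable_ternary summable_ternary]) (auto simp: indicator_def)

lemma ternary_nonneg: "0 \<le> ternary A"
  unfolding ternary_def by (rule suminf_nonneg[OF summable_ternary]) (simp add: indicator_def)

lemma ternary_le: "ternary A \<le> 3/2"
proof -
  have "ternary A \<le> ternary UNIV" by (rule ternary_mono) simp
  also have "ternary UNIV = 3/2" unfolding ternary_def by (simp add: suminf_geometric)
  finally show ?thesis .
qed

lemma ternary_split:
  "ternary A = (\<Sum>k<n. indicator A k * (1/3) ^ k) + (1/3) ^ n * ternary {k. k + n \<in> A}"
proof -
  have "(\<Sum>k. indicator A (k + n) * (1/3 :: real) ^ (k + n))
      = (\<Sum>k. (1/3) ^ n * (indicator {k. k + n \<in> A} k * (1/3) ^ k))"
    by (intro arg_cong[where f = suminf] ext) (simp add: indicator_def power_add)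
  also have "\<dots> = (1/3) ^ n * ternary {k. k + n \<in> A}"
    unfolding ternary_def by (rule suminf_mult[OF summable_ternary])
  finally show ?thesis
    using suminf_split_initial_segment[OF summable_ternary[of A], of n]
    by (simp add: ternary_def)
qed

lemma ternary_close:
  assumes "\<And>k. k < n \<Longrightarrow> k \<in> A \<longleftrightarrow> k \<in> B"
  shows "\<bar>ternary A - ternary B\<bar> \<le> 3/2 * (1/3) ^ n"
proof -
  have "(\<Sum>k<n. indicator A k * (1/3 :: real) ^ k) = (\<Sum>k<n. indicator B k * (1/3) ^ k)"
    using assms by (intro sum.cong) (auto simp: indicator_def)
  then have "ternary A - ternary B
      = (1/3) ^ n * (ternary {k. k + n \<in> A} - ternary {k. k + n \<in> B})"
    by (simp add: ternary_split[of A n] ternary_split[of B n] right_diff_distrib)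
  moreover have "\<bar>ternary {k. k + n \<in> A} - ternary {k. k + n \<in> B}\<bar> \<le> 3/2"
    using ternary_nonneg ternary_le by (smt (verit))
  ultimately show ?thesis by (simp add: abs_mult)
qed

text \<open>The first digit in which two expansions differ outweighs all later ones, since
  \<open>\<Sum>j>k. (1/3) ^ j\<close> is only half of \<open>(1/3) ^ k\<close>.\<close>

lemma ternary_first_difference:
  assumes "\<And>j. j < k \<Longrightarrow> j \<in> A \<longleftrightarrow> j \<in> B" and "k \<in> A" "k \<notin> B"
  shows "(1/3) ^ k / 2 \<le> ternary A - ternary B"
proof -
  have "(\<Sum>j<k. indicator A j * (1/3 :: real) ^ j) = (\<Sum>j<k. indicator B j * (1/3) ^ j)"
    using assms by (intro sum.cong) (auto simp: indicator_def)
  then have "ternary A - ternary B = (1/3) ^ k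
      + (1/3) ^ Suc k * (ternary {j. j + Suc k \<in> A} - ternary {j. j + Suc k \<in> B})"
    using assms(2,3)
    by (simp add: ternary_split[of A "Suc k"] ternary_split[of B "Suc k"] right_diff_distrib)
  moreover have "(1/3 :: real) ^ Suc k * (- 3/2)
      \<le> (1/3) ^ Suc k * (ternary {j. j + Suc k \<in> A} - ternary {j. j + Suc k \<in> B})"
    by (rule mult_left_mono)
      (use ternary_nonneg[of "{j. j + Suc k \<in> A}"] ternary_le[of "{j. j + Suc k \<in> B}"] in auto)
  ultimately show ?thesis by simp
qed

text \<open>Each digit is locally constant on the set of reals with such an expansion.\<close>

lemma ternary_digit_eq:
  assumes "\<bar>ternary A - ternary B\<bar> < (1/3) ^ k / 2"
  shows "k \<in> A \<longleftrightarrow> k \<in> B"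
proof (rule ccontr)
  assume neq: "\<not> ?thesis"
  define j where "j = (LEAST j. (j \<in> A) \<noteq> (j \<in> B))"
  have j: "(j \<in> A) \<noteq> (j \<in> B)" and "j \<le> k"
    unfolding j_def
    using LeastI[of "\<lambda>j. (j \<in> A) \<noteq> (j \<in> B)" k] Least_le[of "\<lambda>j. (j \<in> A) \<noteq> (j \<in> B)" k] neq
    by blast+
  have below: "i \<in> A \<longleftrightarrow> i \<in> B" if "i < j" for i
    using not_less_Least[OF that[unfolded j_def]] by blast
  have "(1/3) ^ j / 2 \<le> \<bar>ternary A - ternary B\<bar>"
  proof (cases "j \<in> A")
    case True
    then have "(1/3) ^ j / 2 \<le> ternary A - ternary B"
      using below j by (intro ternary_first_difference) auto
    then show ?thesis by linarith
  next
    case False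
    then have "(1/3) ^ j / 2 \<le> ternary B - ternary A"
      using below j by (intro ternary_first_difference) auto
    then show ?thesis by linarith
  qed
  moreover have "(1/3 :: real) ^ k \<le> (1/3) ^ j"
    using \<open>j \<le> k\<close> by (intro power_decreasing) auto
  ultimately show False using assms by linarith
qed

lemma inj_ternary: "inj ternary"
proof (rule injI)
  fix A B assume "ternary A = ternary B"
  then have "k \<in> A \<longleftrightarrow> k \<in> B" for k by (intro ternary_digit_eq) simp
  then show "A = B" by blast
qed

lemma ternary_strict_mono: "A \<subset> B \<Longrightarrow> ternary A < ternary B"
  using ternary_mono[of A B] injD[OF inj_ternary, of A B] by fastforce

section \<open>Trees\<close>

locale tree =
  fixes T :: "'a set" and lt :: "'a \<Rightarrow> 'a \<Rightarrow> bool" (infix "\<sqsubset>" 50)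
  assumes tree: "is_tree T (\<sqsubset>)"
begin

lemma irrefl: "x \<in> T \<Longrightarrow> \<not> x \<sqsubset> x"
  using tree by (auto simp: is_tree_def irreflp_on_def)

lemma trans: "x \<sqsubset> y \<Longrightarrow> y \<sqsubset> z \<Longrightarrow> x \<in> T \<Longrightarrow> y \<in> T \<Longrightarrow> z \<in> T \<Longrightarrow> x \<sqsubset> z"
  using tree unfolding is_tree_def by (meson transp_onD)

lemma in_down: "y \<in> down T (\<sqsubset>) x \<longleftrightarrow> y \<in> T \<and> y \<sqsubset> x"
  by (simp add: down_def)

lemma Well_order_height: "x \<in> T \<Longrightarrow> Well_order (height T (\<sqsubset>) x)"
  using tree by (simp add: is_tree_def Field_height)

lemma linear_below:
  assumes "x \<in> T" "y \<in> T" "z \<in> T" "y \<sqsubset> x" "z \<sqsubset> x"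
  shows "y = z \<or> y \<sqsubset> z \<or> z \<sqsubset> y"
proof -
  have "total_on (down T (\<sqsubset>) x) (height T (\<sqsubset>) x)"
    using tree assms(1) unfolding is_tree_def well_order_on_def linear_order_on_def by blast
  then show ?thesis
    using assms unfolding total_on_def height_def down_def by blast
qed

lemma wf_below: "x \<in> T \<Longrightarrow> wf {(y, z). y \<in> T \<and> z \<in> T \<and> y \<sqsubset> z \<and> z \<sqsubset> x}"
proof -
  assume x: "x \<in> T"
  then have "wf (height T (\<sqsubset>) x - Id)"
    using tree by (simp add: is_tree_def well_order_on_def)
  then show ?thesis
  proof (rule wf_subset, clarify)
    fix y z assume "y \<in> T" "z \<in> T" "y \<sqsubset> z" "z \<sqsubset> x"
    then show "(y, z) \<in> height T (\<sqsubset>) x - Id"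
      using trans[of y z x] irrefl[of y] x by (auto simp: height_def down_def)
  qed
qed

lemma height_cong: "down T (\<sqsubset>) x = down T (\<sqsubset>) y \<Longrightarrow> height T (\<sqsubset>) x = height T (\<sqsubset>) y"
  by (simp add: height_def)

text \<open>A proper initial segment of the predecessors of \<open>y\<close> consists of the predecessors of one
  of them, so every ordinal below the height of \<open>y\<close> is itself a height.\<close>

lemma height_attained_below:
  assumes "y \<in> T" and less: "(r, height T (\<sqsubset>) y) \<in> ordLess"
  shows "\<exists>w\<in>T. w \<sqsubset> y \<and> (r, height T (\<sqsubset>) w) \<in> ordIso"
proof -
  have "Well_order r" using less by (simp add: ordLess_def)
  then obtain w where w: "w \<in> Field (height T (\<sqsubset>) y)"
    and iso: "(r, Restr (height T (\<sqsubset>) y) (underS (height T (\<sqsubset>) y) w)) \<in> ordIso"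
    using less Well_order_height[OF assms(1)] ordLess_iff_ordIso_Restr by blast
  have wT: "w \<in> T" "w \<sqsubset> y" using w by (auto simp: Field_height down_def)
  have below: "z \<sqsubset> y" "z \<noteq> w" if "z \<in> T" "z \<sqsubset> w" for z
    using that wT assms(1) trans[of z w y] irrefl[of w] by auto
  have "underS (height T (\<sqsubset>) y) w = down T (\<sqsubset>) w"
    using below wT by (auto simp: underS_def height_def down_def)
  moreover have "Restr (height T (\<sqsubset>) y) (down T (\<sqsubset>) w) = height T (\<sqsubset>) w"
    using below by (auto simp: height_def down_def)
  ultimately show ?thesis using iso wT by auto
qed

text \<open>If the nodes below \<open>Y\<close> form a countable set \<open>W\<close>, consider the nodes of \<open>Y\<close> on levels that
  \<open>W\<close> misses. Two of them cannot have different heights, because the lower height would be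
  attained in \<open>W\<close>. So \<open>Y\<close> is covered by the levels that meet \<open>W\<close> and one further level.\<close>

lemma uncountable_below:
  assumes levels: "\<And>x. x \<in> T \<Longrightarrow> countable (level T (\<sqsubset>) (height T (\<sqsubset>) x))"
    and "Y \<subseteq> T" "uncountable Y"
  shows "uncountable {z\<in>T. \<exists>y\<in>Y. z \<sqsubset> y}"
proof
  define W where "W = {z\<in>T. \<exists>y\<in>Y. z \<sqsubset> y}"
  assume "countable {z\<in>T. \<exists>y\<in>Y. z \<sqsubset> y}"
  then have "countable W" by (simp add: W_def)
  then have "countable (\<Union>w\<in>W. level T (\<sqsubset>) (height T (\<sqsubset>) w))" (is "countable ?L")
    by (rule countable_UN) (rule levels, simp add: W_def)
  then have "uncountable (Y - ?L)"
    using \<open>uncountable Y\<close> by (rule uncountable_minus_countable[rotated])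
  then obtain y0 where y0: "y0 \<in> Y" "y0 \<notin> ?L"
    using infinite_imp_nonempty[OF uncountable_infinite] by blast
  have new_height: "\<not> (height T (\<sqsubset>) a, height T (\<sqsubset>) b) \<in> ordLess"
    if a: "a \<in> Y" "a \<notin> ?L" and b: "b \<in> Y" for a b
  proof
    assume "(height T (\<sqsubset>) a, height T (\<sqsubset>) b) \<in> ordLess"
    then obtain w where "w \<in> T" "w \<sqsubset> b" "(height T (\<sqsubset>) a, height T (\<sqsubset>) w) \<in> ordIso"
      using height_attained_below b assms(2) by blast
    then show False using a b assms(2) by (auto simp: level_def W_def)
  qed
  have "Y - ?L \<subseteq> level T (\<sqsubset>) (height T (\<sqsubset>) y0)"
  proof
    fix y assume y: "y \<in> Y - ?L"
    have wo: "Well_order (height T (\<sqsubset>) y)" "Well_order (height T (\<sqsubset>) y0)"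
      using y y0 assms(2) Well_order_height by auto
    have "(height T (\<sqsubset>) y, height T (\<sqsubset>) y0) \<notin> ordLess"
      "(height T (\<sqsubset>) y0, height T (\<sqsubset>) y) \<notin> ordLess"
      using new_height y y0 by (simp_all del: UN_iff)
    then have "(height T (\<sqsubset>) y, height T (\<sqsubset>) y0) \<in> ordIso"
      by (simp add: not_ordLess_iff_ordLeq wo ordIso_iff_ordLeq)
    then show "y \<in> level T (\<sqsubset>) (height T (\<sqsubset>) y0)"
      using y assms(2) by (auto simp: level_def)
  qed
  then show False
    using \<open>uncountable (Y - ?L)\<close> levels y0 assms(2) countable_subset by blast
qed

end

section \<open>Coding the predecessors of a node by a real number\<close>

locale labelled_tree = tree +
  fixes m :: "'a \<Rightarrow> nat"
  assumes countable_levels: "x \<in> T \<Longrightarrow> countable (level T (\<sqsubset>) (height T (\<sqsubset>) x))"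
    and label_chain: "x \<in> T \<Longrightarrow> y \<in> T \<Longrightarrow> x \<sqsubset> y \<Longrightarrow> m x \<noteq> m y"
    and label_siblings:
      "x \<in> T \<Longrightarrow> y \<in> T \<Longrightarrow> down T (\<sqsubset>) x = down T (\<sqsubset>) y \<Longrightarrow> m x = m y \<Longrightarrow> x = y"
begin

text \<open>Pairs \<open>(m y, m y)\<close> are included since the strict order on the labels would be empty both
  for a root and for an immediate successor of a root.\<close>

definition code :: "'a \<Rightarrow> nat set" where
  "code x = {prod_encode (m z, m y) | z y. y \<in> T \<and> y \<sqsubset> x \<and> z \<in> T \<and> (z = y \<or> z \<sqsubset> y)}"

definition node_real :: "'a \<Rightarrow> real" where
  "node_real x = ternary (code x)"

lemma label_inj_below:
  assumes "x \<in> T" "y \<in> T" "z \<in> T" "y \<sqsubset> x" "z \<sqsubset> x" "m y = m z"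
  shows "y = z"
  using linear_below[OF assms(1-5)] label_chain assms by metis

lemma code_pair:
  "prod_encode (i, j) \<in> code x
     \<longleftrightarrow> (\<exists>z y. y \<in> T \<and> y \<sqsubset> x \<and> z \<in> T \<and> (z = y \<or> z \<sqsubset> y) \<and> m z = i \<and> m y = j)"
  unfolding code_def by auto

lemma code_mono: "x \<in> T \<Longrightarrow> y \<in> T \<Longrightarrow> x \<sqsubset> y \<Longrightarrow> code x \<subseteq> code y"
  unfolding code_def by (clarify, metis trans)

lemma node_real_strict_mono:
  assumes "x \<in> T" "y \<in> T" "x \<sqsubset> y"
  shows "node_real x < node_real y"
proof -
  have "prod_encode (m x, m x) \<in> code y" using assms by (auto simp: code_pair)
  moreover have "prod_encode (m x, m x) \<notin> code x"
    unfolding code_pair using assms(1) label_chain by metis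
  ultimately show ?thesis
    unfolding node_real_def using code_mono[OF assms] by (intro ternary_strict_mono) blast
qed

text \<open>A predecessor \<open>y\<close> of \<open>x\<close> and the predecessor \<open>y'\<close> of \<open>x'\<close> with the same label agree: by
  induction on \<open>y\<close>, the codes show that \<open>y\<close> and \<open>y'\<close> have the same predecessors.\<close>

lemma down_subset_of_code_eq:
  assumes x: "x \<in> T" "x' \<in> T" and eq: "code x = code x'"
  shows "down T (\<sqsubset>) x \<subseteq> down T (\<sqsubset>) x'"
proof
  have "y \<sqsubset> x'" if "y \<in> T" "y \<sqsubset> x" for y
    using wf_below[OF x(1)] that
  proof (induction y rule: wf_induct_rule)
    case (less y)
    have IH: "z \<sqsubset> x'" if "z \<in> T" "z \<sqsubset> y" for z
      using less that x trans by blast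
    have "prod_encode (m y, m y) \<in> code x'"
      using less.prems unfolding eq[symmetric] by (auto simp: code_pair)
    then obtain y' where y': "y' \<in> T" "y' \<sqsubset> x'" "m y' = m y" by (auto simp: code_pair)
    have "z \<sqsubset> y" if z: "z \<in> T" "z \<sqsubset> y'" for z
    proof -
      have "prod_encode (m z, m y) \<in> code x"
        using z y' unfolding eq by (auto simp: code_pair)
      then obtain u v where uv: "v \<in> T" "v \<sqsubset> x" "u \<in> T" "u = v \<or> u \<sqsubset> v" "m u = m z" "m v = m y"
        by (auto simp: code_pair)
      have "v = y" using label_inj_below x uv less.prems by blast
      moreover have "m z \<noteq> m y" using label_chain z y' by metis
      ultimately have "u \<sqsubset> y" using uv by auto
      moreover have "u = z"
        using label_inj_below[of x' u z] IH[OF \<open>u \<in> T\<close> \<open>u \<sqsubset> y\<close>] trans[OF z(2) y'(2)] x y' z uv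
        by blast
      ultimately show ?thesis by simp
    qed
    moreover have "z \<sqsubset> y'" if z: "z \<in> T" "z \<sqsubset> y" for z
    proof -
      have "prod_encode (m z, m y) \<in> code x'"
        using z less.prems unfolding eq[symmetric] by (auto simp: code_pair)
      then obtain u v where uv: "v \<in> T" "v \<sqsubset> x'" "u \<in> T" "u = v \<or> u \<sqsubset> v" "m u = m z" "m v = m y"
        by (auto simp: code_pair)
      have "v = y'" using label_inj_below x uv y' by metis
      moreover have "m z \<noteq> m y" using label_chain z less.prems by blast
      ultimately have "u \<sqsubset> y'" using uv y' by auto
      moreover have "u = z"
        using label_inj_below[of x' u z] IH[OF z] trans[OF \<open>u \<sqsubset> y'\<close> y'(2)] x y' z uv by blast
      ultimately show ?thesis by simp
    qed
    ultimately have "down T (\<sqsubset>) y = down T (\<sqsubset>) y'" by (auto simp: down_def)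
    then have "y = y'" using label_siblings y' less.prems by metis
    then show ?case using y' by simp
  qed
  then show "y \<in> down T (\<sqsubset>) x'" if "y \<in> down T (\<sqsubset>) x" for y
    using that by (simp add: in_down)
qed

lemma node_real_inj:
  assumes "x \<in> T" "y \<in> T" "node_real x = node_real y"
  shows "down T (\<sqsubset>) x = down T (\<sqsubset>) y"
proof -
  have "code x = code y" using assms(3) inj_ternary by (auto simp: node_real_def dest: injD)
  then show ?thesis using down_subset_of_code_eq assms(1,2) by blast
qed

section \<open>Continuity\<close>

lemma limit_no_last_below:
  assumes "is_limit_ord (height T (\<sqsubset>) y)" "y \<in> T" "w \<in> T" "w \<sqsubset> y"
  shows "\<exists>x\<in>T. x \<sqsubset> y \<and> w \<sqsubset> x"
proof -
  have "w \<in> down T (\<sqsubset>) y" using assms by (simp add: in_down)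
  then obtain x where x: "x \<in> down T (\<sqsubset>) y" "(x, w) \<notin> height T (\<sqsubset>) y"
    using assms(1) unfolding is_limit_ord_def Field_height by blast
  then have "x \<noteq> w" "\<not> x \<sqsubset> w" "x \<in> T" "x \<sqsubset> y"
    using assms by (auto simp: height_def down_def)
  then show ?thesis using linear_below assms by blast
qed

text \<open>At a limit node the code is the union of the codes of its predecessors, so finitely many of
  its elements are already present at some predecessor.\<close>

lemma code_limit_finite_part:
  assumes lim: "is_limit_ord (height T (\<sqsubset>) y)" and y: "y \<in> T"
  shows "\<exists>x\<in>T. x \<sqsubset> y \<and> (\<forall>k<n. k \<in> code y \<longrightarrow> k \<in> code x)"
proof (induction n)
  case 0
  have "down T (\<sqsubset>) y \<noteq> {}" using lim by (simp add: is_limit_ord_def Field_height)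
  then show ?case by (auto simp: down_def)
next
  case (Suc n)
  then obtain x where x: "x \<in> T" "x \<sqsubset> y" "\<forall>k<n. k \<in> code y \<longrightarrow> k \<in> code x" by blast
  show ?case
  proof (cases "n \<in> code y")
    case True
    then obtain z w where w: "w \<in> T" "w \<sqsubset> y" "z \<in> T" "z = w \<or> z \<sqsubset> w" "n = prod_encode (m z, m w)"
      by (auto simp: code_def)
    obtain v where v: "v \<in> T" "v \<sqsubset> y" "w \<sqsubset> v"
      using limit_no_last_below[OF lim y] w by blast
    then have "n \<in> code v" using w by (auto simp: code_pair)
    consider "x = v \<or> x \<sqsubset> v" | "v \<sqsubset> x" using linear_below x v y by blast
    then show ?thesis
    proof cases
      case 1
      then have "code x \<subseteq> code v" using code_mono x v by blast
      then show ?thesis using x v \<open>n \<in> code v\<close> less_Suc_eq by (intro bexI[of _ v]) auto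
    next
      case 2
      then have "code v \<subseteq> code x" using code_mono x v by blast
      then show ?thesis using x \<open>n \<in> code v\<close> less_Suc_eq by (intro bexI[of _ x]) auto
    qed
  next
    case False
    then show ?thesis using x less_Suc_eq by (intro bexI[of _ x]) auto
  qed
qed

lemma continuous_node_real: "continuous_map (tree_topology T (\<sqsubset>)) euclidean node_real"
proof -
  have "tree_open T (\<sqsubset>) {x\<in>T. node_real x \<in> U}" if "open U" for U
    unfolding tree_open_def
  proof (intro conjI ballI impI)
    fix y assume y: "y \<in> {x\<in>T. node_real x \<in> U}" and lim: "is_limit_ord (height T (\<sqsubset>) y)"
    obtain e where e: "e > 0" "\<And>r. dist r (node_real y) < e \<Longrightarrow> r \<in> U"
      using y \<open>open U\<close> unfolding open_dist by blast
    \<comment> \<open>Expansions that agree below \<open>n\<close> differ by at most \<open>3/2 * (1/3) ^ n\<close>.\<close>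
    obtain n where n: "(1/3 :: real) ^ n < e / 3 * 2"
      using real_arch_pow_inv[of "e / 3 * 2" "1/3"] e(1) by auto
    obtain x where x: "x \<in> T" "x \<sqsubset> y" "\<forall>k<n. k \<in> code y \<longrightarrow> k \<in> code x"
      using code_limit_finite_part[OF lim] y by blast
    have "node_real v \<in> U" if v: "v \<in> T" "x \<sqsubset> v" "v \<sqsubset> y" for v
    proof (rule e(2))
      have "code x \<subseteq> code v" "code v \<subseteq> code y" using code_mono x v y by auto
      then have "\<bar>node_real v - node_real y\<bar> \<le> 3/2 * (1/3) ^ n"
        unfolding node_real_def using x(3) by (intro ternary_close) blast
      then show "dist (node_real v) (node_real y) < e" using n by (simp add: dist_real_def)
    qed
    then show "\<exists>x\<in>T. x \<sqsubset> y \<and> up T (\<sqsubset>) x \<inter> down T (\<sqsubset>) y \<subseteq> {x\<in>T. node_real x \<in> U}"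
      using x by (intro bexI[of _ x]) (auto simp: up_def down_def)
  qed auto
  then show ?thesis
    by (simp add: continuous_map_def openin_tree_topology[OF tree] topspace_tree_topology[OF tree])
qed

section \<open>Compact sets of codes are countable\<close>

text \<open>One pigeonhole step: uncountably many nodes lie below the nodes of \<open>Y\<close>, and there are only
  countably many labels.\<close>

lemma uncountable_below_same_label:
  assumes "Y \<subseteq> T" "uncountable Y"
  shows "\<exists>s. uncountable {z\<in>T. m z = s \<and> (\<exists>y\<in>Y. z \<sqsubset> y)}"
proof (rule ccontr)
  assume "\<not> ?thesis"
  then have "countable (\<Union>s. {z\<in>T. m z = s \<and> (\<exists>y\<in>Y. z \<sqsubset> y)})" by auto
  moreover have "(\<Union>s. {z\<in>T. m z = s \<and> (\<exists>y\<in>Y. z \<sqsubset> y)}) = {z\<in>T. \<exists>y\<in>Y. z \<sqsubset> y}" by auto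
  ultimately show False using uncountable_below[OF countable_levels assms] by simp
qed

text \<open>Iterating the pigeonhole step from \<open>X\<close> yields uncountable sets of nodes, each below the
  previous one and with constant labels \<open>s 0, s 1, \<dots>\<close>. Climbing back up from the set with
  label \<open>s n\<close> leads to a node of \<open>X\<close> whose code contains the first \<open>n\<close> steps of the descent.\<close>

lemma uncountable_common_descent:
  assumes "X \<subseteq> T" "uncountable X"
  shows "\<exists>s. (\<forall>i. s (Suc i) \<noteq> s i) \<and>
    (\<forall>n. \<exists>x\<in>X. \<forall>i<n. prod_encode (s (Suc i), s i) \<in> code x)"
proof -
  obtain g where g:
    "\<And>Y. Y \<subseteq> T \<Longrightarrow> uncountable Y \<Longrightarrow> uncountable {z\<in>T. m z = g Y \<and> (\<exists>y\<in>Y. z \<sqsubset> y)}"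
    using uncountable_below_same_label by metis
  define Y where "Y = rec_nat X (\<lambda>_ Y. {z\<in>T. m z = g Y \<and> (\<exists>y\<in>Y. z \<sqsubset> y)})"
  define s where "s n = g (Y n)" for n
  have Y0: "Y 0 = X" and s: "Y (Suc n) = {z\<in>T. m z = s n \<and> (\<exists>y\<in>Y n. z \<sqsubset> y)}" for n
    by (simp_all add: Y_def s_def)
  have Y: "Y n \<subseteq> T \<and> uncountable (Y n)" for n
  proof (induction n)
    case 0
    then show ?case using assms Y0 by simp
  next
    case (Suc n)
    then have "uncountable (Y (Suc n))" unfolding s s_def by (intro g) auto
    then show ?case by (simp add: s)
  qed
  have nonempty: "\<exists>z. z \<in> Y n" for n
    using infinite_imp_nonempty[OF uncountable_infinite] Y by blast
  have climb: "\<exists>x\<in>X. z \<sqsubset> x \<and> (\<forall>i<n. prod_encode (s (Suc i), s i) \<in> code x)"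
    if "z \<in> Y (Suc n)" for z n
    using that
  proof (induction n arbitrary: z)
    case 0
    then show ?case using s[of 0] Y0 by auto
  next
    case (Suc n)
    then obtain y where y: "z \<in> T" "m z = s (Suc n)" "y \<in> Y (Suc n)" "z \<sqsubset> y"
      using s[of "Suc n"] by auto
    then obtain x where x: "x \<in> X" "y \<sqsubset> x" "\<forall>i<n. prod_encode (s (Suc i), s i) \<in> code x"
      using Suc.IH by blast
    have yT: "y \<in> T" "m y = s n" using y(3) s[of n] by auto
    then have "prod_encode (s (Suc n), s n) \<in> code x"
      unfolding code_pair using x(2) y by blast
    moreover have "z \<sqsubset> x" using trans[OF y(4) x(2) y(1) yT(1)] x(1) assms(1) by blast
    ultimately show ?case using x less_Suc_eq by (intro bexI[of _ x]) auto
  qed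
  have "s (Suc i) \<noteq> s i" for i
  proof -
    obtain z where "z \<in> Y (Suc (Suc i))" using nonempty by blast
    then obtain y where "z \<in> T" "m z = s (Suc i)" "y \<in> Y (Suc i)" "z \<sqsubset> y"
      using s[of "Suc i"] by auto
    moreover then have "y \<in> T" "m y = s i" using s[of i] by auto
    ultimately show ?thesis using label_chain by metis
  qed
  moreover have "\<exists>x\<in>X. \<forall>i<n. prod_encode (s (Suc i), s i) \<in> code x" for n
    using climb nonempty by blast
  ultimately show ?thesis by blast
qed

text \<open>The predecessors of \<open>x\<close> are determined by their labels, so a descending sequence of labels
  would lift to a descending sequence of predecessors.\<close>

lemma code_no_descent:
  assumes x: "x \<in> T" and neq: "\<And>i. s (Suc i) \<noteq> s i"
  shows "\<exists>i. prod_encode (s (Suc i), s i) \<notin> code x"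
proof (rule ccontr)
  assume "\<not> ?thesis"
  then have "\<forall>i. prod_encode (s (Suc i), s i) \<in> code x" by simp
  then have "\<forall>i. \<exists>z y. y \<in> T \<and> y \<sqsubset> x \<and> z \<in> T \<and> (z = y \<or> z \<sqsubset> y) \<and> m z = s (Suc i) \<and> m y = s i"
    unfolding code_pair .
  then obtain z y where zy: "\<And>i. y i \<in> T" "\<And>i. y i \<sqsubset> x" "\<And>i. z i \<in> T"
    "\<And>i. z i = y i \<or> z i \<sqsubset> y i" "\<And>i. m (z i) = s (Suc i)" "\<And>i. m (y i) = s i" by metis
  have less: "z i \<sqsubset> y i" for i using zy(4-6)[of i] neq[of i] by metis
  have "z i = y (Suc i)" for i
    using label_inj_below[OF x zy(3,1) trans[OF less zy(2) zy(3,1) x] zy(2)] zy(5,6) by simp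
  then have "y (Suc i) \<sqsubset> y i" for i using less by metis
  then show False
    using wf_below[OF x] zy unfolding wf_iff_no_infinite_down_chain by blast
qed

lemma countable_compact_subset:
  assumes "compact C" "C \<subseteq> node_real ` T"
  shows "countable C"
proof (rule ccontr)
  define X where "X = {x\<in>T. node_real x \<in> C}"
  assume "uncountable C"
  moreover have "C = node_real ` X" using assms(2) by (auto simp: X_def)
  ultimately have "uncountable X" by auto
  moreover have "X \<subseteq> T" by (auto simp: X_def)
  ultimately obtain s where neq: "\<And>i. s (Suc i) \<noteq> s i"
    and descent: "\<And>n. \<exists>x\<in>X. \<forall>i<n. prod_encode (s (Suc i), s i) \<in> code x"
    using uncountable_common_descent[of X] by auto
  have "\<exists>x. \<forall>n. x n \<in> X \<and> (\<forall>i<n. prod_encode (s (Suc i), s i) \<in> code (x n))"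
    using descent by (intro choice allI) blast
  then obtain x where x: "\<And>n. x n \<in> X"
    "\<And>n i. i < n \<Longrightarrow> prod_encode (s (Suc i), s i) \<in> code (x n)" by blast
  have "\<forall>n. node_real (x n) \<in> C" using x(1) by (simp add: X_def)
  then obtain c r where c: "c \<in> C" and r: "strict_mono r"
    and "((\<lambda>n. node_real (x n)) \<circ> r) \<longlonglongrightarrow> c"
    by (rule seq_compactE[OF compact_imp_seq_compact[OF assms(1)]])
  then have lim: "(\<lambda>n. node_real (x (r n))) \<longlonglongrightarrow> c" by (simp add: o_def)
  obtain x' where x': "x' \<in> T" "c = node_real x'" using c assms(2) by blast
  \<comment> \<open>The corresponding digit is \<open>1\<close> for almost all members of the sequence, hence in the limit.\<close>
  have "prod_encode (s (Suc i), s i) \<in> code x'" for i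
  proof -
    define k where "k = prod_encode (s (Suc i), s i)"
    have "\<forall>\<^sub>F n in sequentially. dist (node_real (x (r n))) c < (1/3) ^ k / 2"
      using lim by (rule tendstoD) simp
    moreover have "\<forall>\<^sub>F n in sequentially. i < r n"
      by (rule eventually_compose_filterlim[OF eventually_gt_at_top filterlim_subseq[OF r]])
    ultimately have "\<forall>\<^sub>F n in sequentially. dist (node_real (x (r n))) c < (1/3) ^ k / 2 \<and> i < r n"
      by (rule eventually_conj)
    then obtain n where "dist (node_real (x (r n))) c < (1/3) ^ k / 2" "i < r n"
      using eventually_happens'[OF sequentially_bot] by blast
    then show ?thesis
      using ternary_digit_eq[of "code (x (r n))" "code x'" k] x(2)[of i "r n"]
      by (simp add: dist_real_def node_real_def x'(2) k_def)
  qed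
  then show False using code_no_descent[of x' s] x'(1) neq by blast
qed

end

section \<open>Special Aronszajn trees\<close>

lemma cantor_subset_compact_uncountable:
  fixes C :: "'a::topological_space set"
  assumes "is_cantor_subset C"
  shows "compact C" "uncountable C"
proof -
  let ?P = "product_topology (\<lambda>_::nat. discrete_topology (UNIV :: bool set)) UNIV"
  have hom: "top_of_set C homeomorphic_space ?P"
    using assms by (simp add: is_cantor_subset_def)
  have "compact_space ?P" by (simp add: compact_space_product_topology compact_space_discrete_topology)
  then have "compact_space (top_of_set C)"
    using homeomorphic_compact_space[OF hom] by simp
  then show "compact C" by (simp add: compactin_subspace flip: compactin_euclidean_iff)
  obtain f where "homeomorphic_map (top_of_set C) ?P f"
    using hom homeomorphic_space by blast
  then have f: "f ` C = UNIV"
    by (auto dest: homeomorphic_imp_surjective_map)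
  show "uncountable C"
  proof
    assume "countable C"
    then have "countable (UNIV :: (nat \<Rightarrow> bool) set)" unfolding f[symmetric] by simp
    then obtain g :: "nat \<Rightarrow> nat \<Rightarrow> bool" where g: "range g = UNIV"
      using countable_as_injective_image uncountable_def by (metis UNIV_not_empty)
    have "(\<lambda>n. \<not> g n n) \<in> range g" by (simp add: g)
    then show False by (auto dest: fun_cong)
  qed
qed

text \<open>The label combines the index of an antichain containing the node, which separates comparable
  nodes, with the position of the node in an enumeration of its level.\<close>

lemma special_aronszajn_labelling:
  assumes "is_special_aronszajn_tree T lt"
  shows "\<exists>m. labelled_tree T lt m"
proof -
  have w1: "is_omega1_tree T lt"
    using assms by (simp add: is_special_aronszajn_tree_def is_aronszajn_tree_def)
  then have tree: "is_tree T lt" by (simp add: is_omega1_tree_def)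
  interpret tree T lt by unfold_locales (rule tree)
  obtain A :: "nat \<Rightarrow> 'a set" where A: "\<And>n. is_antichain T lt (A n)" "T = (\<Union>n. A n)"
    using assms unfolding is_special_aronszajn_tree_def by blast
  then obtain a where a: "\<And>x. x \<in> T \<Longrightarrow> x \<in> A (a x)" by (metis UN_iff)
  define pos where "pos x = to_nat_on (level T lt (height T lt x)) x" for x
  have "labelled_tree T lt (\<lambda>x. prod_encode (a x, pos x))"
  proof
    show "countable (level T lt (height T lt x))" for x
      by (rule countable_level[OF w1])
  next
    fix x y assume xy: "x \<in> T" "y \<in> T" "lt x y"
    then have "x \<noteq> y" using irrefl by blast
    moreover have "pairwise (\<lambda>x y. \<not> lt x y \<and> \<not> lt y x) (A (a x))"
      using A(1) by (simp add: is_antichain_def)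
    ultimately have "a x \<noteq> a y" using a xy unfolding pairwise_def by metis
    then show "prod_encode (a x, pos x) \<noteq> prod_encode (a y, pos y)" by simp
  next
    fix x y
    assume xy: "x \<in> T" "y \<in> T" "down T lt x = down T lt y"
      "prod_encode (a x, pos x) = prod_encode (a y, pos y)"
    let ?L = "level T lt (height T lt x)"
    have "height T lt x = height T lt y" using height_cong xy(3) by blast
    then have "to_nat_on ?L x = to_nat_on ?L y" and "x \<in> ?L" "y \<in> ?L"
      using xy Well_order_height by (auto simp: pos_def level_def intro: ordIso_reflexive)
    then show "x = y" using countable_level[OF w1] by (metis to_nat_on_inj)
  qed
  then show ?thesis by blast
qed

theorem theorem1p2:
  fixes T :: "'a set" and lt :: "'a \<Rightarrow> 'a \<Rightarrow> bool" (infix "\<sqsubset>" 50)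
  assumes "is_special_aronszajn_tree T (\<sqsubset>)"
  shows "\<exists>(B :: real set) (\<psi> :: 'a \<Rightarrow> real).
    \<not> (\<exists>C\<subseteq>B. is_cantor_subset C) \<and>
    \<psi> \<in> T \<rightarrow> B \<and>
    continuous_map (tree_topology T (\<sqsubset>)) (top_of_set B) \<psi> \<and>
    (\<forall>x\<in>T. \<forall>y\<in>T. x \<sqsubset> y \<longrightarrow> \<psi> x < \<psi> y) \<and>
    (\<forall>x\<in>T. \<forall>y\<in>T. down T (\<sqsubset>) x \<noteq> down T (\<sqsubset>) y \<longrightarrow> \<psi> x \<noteq> \<psi> y)"
proof -
  obtain m where "labelled_tree T (\<sqsubset>) m"
    using special_aronszajn_labelling[OF assms] by blast
  then interpret labelled_tree T "(\<sqsubset>)" m .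
  have "\<not> (\<exists>C\<subseteq>node_real ` T. is_cantor_subset C)"
    using cantor_subset_compact_uncountable countable_compact_subset by blast
  moreover have
    "continuous_map (tree_topology T (\<sqsubset>)) (top_of_set (node_real ` T)) node_real"
    using continuous_node_real topspace_tree_topology[OF tree]
    by (auto simp: continuous_map_in_subtopology)
  ultimately show ?thesis
    using node_real_strict_mono node_real_inj
    by (intro exI[of _ "node_real ` T"] exI[of _ node_real]) blast
qed

end
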